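(* Let $R>0$, let $n$ be an even positive integer, and let $f_n$ be the trigonometric interpolant on $[-R,R]^3$ of a distribution function $f$ known at the collocation points. Then the spectral collocation operator $\mathcal{C}_n^R$ defined in the context preserves mass: $$\int_{[-R,R]^3}\mathcal{C}_n^R(f_n,f_n)\,\mathrm{d}\boldsymbol v=\int_{[-R,R]^3}\mathrm{div}_{\boldsymbol v}\,\mathcal{I}_n\left(\nabla_{\boldsymbol v}^2 g_{2n}^R\,\nabla_{\boldsymbol v} f_n-\nabla_{\boldsymbol v}\Delta_{\boldsymbol v} g_{2n}^R\, f_n\right)\mathrm{d}\boldsymbol v=0.$$
   Context: Fix $R>0$ and let $T=2R$. For an even positive integer $n$, let $\mathcal{J}_n=\{-n/2,\dots,n/2-1\}^3$ and $\mathcal{J}_{2n}=\{-n,\dots,n-1\}^3$. The collocation points are $\boldsymbol v_j=\frac{2R}{n}\,j$; those with $j\in\mathcal{J}_n$ lie in $[-R,R]^3$ and those with $j\in\mathcal{J}_{2n}$ lie in $[-T,T]^3$. Interpolation on $[-R,R]^3$: for a function $h$ with values at the points $\boldsymbol v_j$, $j\in\mathcal{J}_n$, set $\mathcal{I}_n h(\boldsymbol v)=\sum_{\boldsymbol k\in\mathcal{J}_n}\widetilde h_n(\boldsymbol k)e^{\frac{i\pi}{R}\boldsymbol k\cdot\boldsymbol v}$ with $\widetilde h_n(\boldsymbol k)=\frac1{n^3}\sum_{j\in\mathcal{J}_n}h(\boldsymbol v_j)e^{-\frac{i\pi}{R}\boldsymbol k\cdot\boldsymbol v_j}$, so that $(\mathcal{I}_n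 h)(\boldsymbol v_j)=h(\boldsymbol v_j)$ for $j\in\mathcal{J}_n$. It acts componentwise on vector-valued functions. Set $f_n=\mathcal{I}_n f$. Discrete convolution on $[-T,T]^3$: set the values $f(\boldsymbol v_j)=0$ for $j\in\mathcal{J}_{2n}\setminus\mathcal{J}_n$, and define $$\widetilde f_{2n}(\boldsymbol k)=\frac1{(2n)^3}\sum_{j\in\mathcal{J}_{2n}}f(\boldsymbol v_j)e^{-\frac{i\pi}{T}\boldsymbol k\cdot\boldsymbol v_j},\qquad \widetilde\psi(\boldsymbol k)=\int_{[-T,T]^3}|\boldsymbol u|\,e^{-\frac{i\pi}{T}\boldsymbol k\cdot\boldsymbol u}\,\mathrm{d}\boldsymbol u,$$ $$g^R_{2n}(\boldsymbol v)=\sum_{\boldsymbol k\in\mathcal{J}_{2n}}\widetilde f_{2n}(\boldsymbol k)\,\widetilde\psi(\boldsymbol k)\,e^{\frac{i\pi}{T}\boldsymbol k\cdot\boldsymbol v}.$$ Collocation operator: $$\mathcal{C}_n^R(f_n,f_n)=\mathrm{div}_{\boldsymbol v}\,\mathcal{I}_n\left(\nabla_{\boldsymbol v}^2 g_{2n}^R\,\nabla_{\boldsymbol v} f_n-\nabla_{\boldsymbol v}\Delta_{\boldsymbol v} g_{2n}^R\, f_n\right),$$ where $\nabla^2_{\boldsymbol v} g^R_{2n}$ is the Hessian matrix acting on the vector $\nabla_{\boldsymbol v} f_n$. *)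

theory Defs
  imports "HOL-Analysis.Analysis"
begin

definition grid_index :: "nat \<Rightarrow> (int ^ 3) set" where
  "grid_index m = {k. \<forall>i. - (int m div 2) \<le> k $ i \<and> k $ i \<le> int m div 2 - 1}"

definition rvec :: "int ^ 3 \<Rightarrow> real ^ 3" where
  "rvec k = (\<chi> i. real_of_int (k $ i))"

definition cube :: "real \<Rightarrow> (real ^ 3) set" where
  "cube L = cbox (\<chi> i. - L) (\<chi> i. L)"

definition colloc_pt :: "real \<Rightarrow> nat \<Rightarrow> int ^ 3 \<Rightarrow> real ^ 3" where
  "colloc_pt R n j = (2 * R / real n) *\<^sub>R rvec j"

definition phase :: "real \<Rightarrow> int ^ 3 \<Rightarrow> real ^ 3 \<Rightarrow> complex" where
  "phase L k v = \<i> * complex_of_real (pi / L * (rvec k \<bullet> v))"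

definition interp_coeff :: "real \<Rightarrow> nat \<Rightarrow> (real ^ 3 \<Rightarrow> complex) \<Rightarrow> int ^ 3 \<Rightarrow> complex" where
  "interp_coeff R n h k =
     1 / of_nat n ^ 3 *
       (\<Sum>j\<in>grid_index n. h (colloc_pt R n j) * exp (- phase R k (colloc_pt R n j)))"

definition interp :: "real \<Rightarrow> nat \<Rightarrow> (real ^ 3 \<Rightarrow> complex) \<Rightarrow> real ^ 3 \<Rightarrow> complex" where
  "interp R n h v = (\<Sum>k\<in>grid_index n. interp_coeff R n h k * exp (phase R k v))"

definition interp_vec ::
  "real \<Rightarrow> nat \<Rightarrow> (real ^ 3 \<Rightarrow> complex ^ 3) \<Rightarrow> real ^ 3 \<Rightarrow> complex ^ 3" where
  "interp_vec R n H v = (\<chi> i. interp R n (\<lambda>w. H w $ i) v)"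

text \<open>The interpolant of a real \<open>f\<close> is in general complex-valued off the collocation points,
  since the index set is not symmetric under negation.\<close>

definition interpolant :: "real \<Rightarrow> nat \<Rightarrow> (real ^ 3 \<Rightarrow> real) \<Rightarrow> real ^ 3 \<Rightarrow> complex" where
  "interpolant R n f = interp R n (\<lambda>v. complex_of_real (f v))"

text \<open>The values of \<open>f\<close> at the points of the doubled grid outside the original one are replaced
  by zero. Since \<open>T / (2 n) = R / n\<close>, both grids have the same spacing, hence the same
  \<open>colloc_pt R n\<close>.\<close>

definition padded_coeff :: "real \<Rightarrow> nat \<Rightarrow> (real ^ 3 \<Rightarrow> real) \<Rightarrow> int ^ 3 \<Rightarrow> complex" where
  "padded_coeff R n f k =
     1 / of_nat (2 * n) ^ 3 *
       (\<Sum>j\<in>grid_index (2 * n).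
          (if j \<in> grid_index n then complex_of_real (f (colloc_pt R n j)) else 0) *
          exp (- phase (2 * R) k (colloc_pt R n j)))"

definition kernel_coeff :: "real \<Rightarrow> int ^ 3 \<Rightarrow> complex" where
  "kernel_coeff T k =
     (LINT u:cube T|lborel. complex_of_real (norm u) * exp (- phase T k u))"

definition conv_potential :: "real \<Rightarrow> nat \<Rightarrow> (real ^ 3 \<Rightarrow> real) \<Rightarrow> real ^ 3 \<Rightarrow> complex" where
  "conv_potential R n f v =
     (\<Sum>k\<in>grid_index (2 * n).
        padded_coeff R n f k * kernel_coeff (2 * R) k * exp (phase (2 * R) k v))"

definition partial :: "3 \<Rightarrow> (real ^ 3 \<Rightarrow> complex) \<Rightarrow> real ^ 3 \<Rightarrow> complex" where
  "partial i h v = frechet_derivative h (at v) (axis i 1)"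

definition grad :: "(real ^ 3 \<Rightarrow> complex) \<Rightarrow> real ^ 3 \<Rightarrow> complex ^ 3" where
  "grad h v = (\<chi> i. partial i h v)"

definition hessian :: "(real ^ 3 \<Rightarrow> complex) \<Rightarrow> real ^ 3 \<Rightarrow> complex ^ 3 ^ 3" where
  "hessian h v = (\<chi> i j. partial i (partial j h) v)"

definition divergence :: "(real ^ 3 \<Rightarrow> complex ^ 3) \<Rightarrow> real ^ 3 \<Rightarrow> complex" where
  "divergence F v = (\<Sum>i\<in>UNIV. partial i (\<lambda>w. F w $ i) v)"

definition laplacian :: "(real ^ 3 \<Rightarrow> complex) \<Rightarrow> real ^ 3 \<Rightarrow> complex" where
  "laplacian h v = (\<Sum>i\<in>UNIV. partial i (partial i h) v)"

text \<open>The operator \<open>C(f_n, f_n)\<close> as a function of the data \<open>f\<close>: only the values of \<open>f\<close> at the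
  collocation points enter, and these determine and are determined by \<open>f_n = interpolant R n f\<close>.\<close>

definition collocation_op :: "real \<Rightarrow> nat \<Rightarrow> (real ^ 3 \<Rightarrow> real) \<Rightarrow> real ^ 3 \<Rightarrow> complex" where
  "collocation_op R n f =
     divergence (interp_vec R n (\<lambda>v.
       hessian (conv_potential R n f) v *v grad (interpolant R n f) v
       - interpolant R n f v *s grad (laplacian (conv_potential R n f)) v))"

end

(* The collocation operator is the divergence of a trigonometric polynomial, so its constant mode
   is multiplied by zero, and every other mode integrates to zero over the period cell. *)
theory Submission
  imports Defs
begin

text \<open>For any field \<open>H\<close>, \<open>interp_vec R n H\<close> is a finite Fourier sum
  of period 2R in each coordinate. The i-th term of its divergence multiplies the mode k by i pi k_i
  / R. If k_i = 0, this factor is zero. If k_i is nonzero, the mode is a product of one-variable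
  exponentials, and the factor in direction i runs through |k_i| full periods, so it integrates to
  zero (\<open>integral_exp_period\<close>, \<open>integral_exp_phase\<close>). Summing over the
  finitely many modes gives \<open>integral_divergence_interp_vec\<close>, and the collocation
  operator is the instance of a particular \<open>H\<close>.\<close>

lemma has_derivative_interp:
  "(interp R n h has_derivative
     (\<lambda>d. \<Sum>k\<in>grid_index n. interp_coeff R n h k * (exp (phase R k v) * phase R k d))) (at v)"
proof -
  \<comment> \<open>The phase is linear in \<open>v\<close>, hence its own derivative.\<close>
  have "(phase R k has_derivative phase R k) (at v)" for k
    unfolding phase_def [abs_def]
    by (intro has_derivative_mult_right has_derivative_of_real has_derivative_inner_right
        has_derivative_ident)
  then show ?thesis
    unfolding interp_def [abs_def]
    by (intro has_derivative_sum has_derivative_mult_right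
        has_derivative_compose [OF _ DERIV_exp [unfolded has_field_derivative_def]])
qed

text \<open>\<open>frechet_derivative\<close> is defined by choice; uniqueness of the derivative
  identifies it with the explicit one.\<close>

lemma partial_interp:
  "partial i (interp R n h) v =
     (\<Sum>k\<in>grid_index n.
        interp_coeff R n h k * phase R k (axis i 1) * exp (phase R k v))"
  using frechet_derivative_at [OF has_derivative_interp, of R n h v, symmetric]
  by (simp add: partial_def mult_ac)

lemma divergence_interp_vec:
  "divergence (interp_vec R n H) v =
     (\<Sum>i\<in>UNIV. \<Sum>k\<in>grid_index n.
        interp_coeff R n (\<lambda>w. H w $ i) k * phase R k (axis i 1) * exp (phase R k v))"
  by (simp add: divergence_def interp_vec_def partial_interp)

lemma phase_axis: "phase R k (axis i 1) = \<i> * complex_of_real (pi / R * real_of_int (k $ i))"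
  by (simp add: phase_def rvec_def inner_axis)

lemma set_integrable_exp_phase: "set_integrable lborel (cube R) (\<lambda>v. exp (phase R k v))"
  unfolding cube_def phase_def
  by (intro borel_integrable_compact[folded set_integrable_def] continuous_intros compact_cbox)

text \<open>This product form lets the integral over the cube split by Fubini.\<close>

lemma indicator_cube:
  "indicator (cube R) v = (\<Prod>b\<in>Basis. indicator {-R..R} (v \<bullet> b) :: real)"
proof (cases "v \<in> cube R")
  case True
  then have "v \<bullet> b \<in> {-R..R}" if "b \<in> Basis" for b
    using that by (auto simp: cube_def mem_box_cart Basis_vec_def inner_axis)
  with True show ?thesis by simp
next
  case False
  then obtain i where "v $ i \<notin> {-R..R}"
    by (auto simp: cube_def mem_box_cart)
  then have "axis i 1 \<in> (Basis :: (real^3) set)" "indicator {-R..R} (v \<bullet> axis i 1) = (0::real)"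
    by (simp_all add: inner_axis)
  then have "(\<Prod>b\<in>Basis. indicator {-R..R} (v \<bullet> b) :: real) = 0"
    by (meson finite_Basis prod_zero)
  with False show ?thesis by simp
qed

lemma integral_exp_period:
  fixes m :: int
  assumes "R > 0" "m \<noteq> 0"
  shows "(LINT x:{-R..R}|lborel. exp (\<i> * complex_of_real (pi / R * (m * x)))) = 0"
proof -
  define a where "a = \<i> * complex_of_real (pi / R * m)"
  have a: "a \<noteq> 0" using assms by (simp add: a_def)
  have eq: "exp (\<i> * complex_of_real (pi / R * (m * x))) = exp (a * complex_of_real x)" for x :: real
    by (simp add: a_def mult_ac)
  have "(LINT x:{-R..R}|lborel. exp (a * complex_of_real x))
      = exp (a * complex_of_real R) / a - exp (a * complex_of_real (-R)) / a"
    unfolding set_lebesgue_integral_def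
  proof (rule integral_FTC_Icc)
    show "-R \<le> R" using assms by simp
    show "((\<lambda>x. exp (a * complex_of_real x) / a) has_vector_derivative exp (a * complex_of_real x))
        (at x within {-R..R})" for x
      by (rule has_vector_derivative_real_field)
         (auto intro!: derivative_eq_intros simp: a)
    show "continuous_on {-R..R} (\<lambda>x. exp (a * complex_of_real x))"
      by (intro continuous_intros)
  qed
  \<comment> \<open>The interval has length 2R, so the exponents at its ends differ by a multiple of
    the period of \<open>exp\<close>, and the antiderivative takes equal values there.\<close>
  moreover have "a * complex_of_real R = a * complex_of_real (-R) + 2 * of_int m * pi * \<i>"
    using assms by (simp add: a_def field_simps)
  then have "exp (a * complex_of_real R) = exp (a * complex_of_real (-R))"
    unfolding exp_eq by (intro exI[of _ m]) simp
  ultimately show ?thesis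
    unfolding eq by simp
qed

lemma integral_exp_phase:
  assumes "R > 0" "k $ i \<noteq> 0"
  shows "(LINT v:cube R|lborel. exp (phase R k v)) = 0"
proof -
  define g :: "real^3 \<Rightarrow> real \<Rightarrow> complex" where
    "g b x = indicator {-R..R} x *\<^sub>R exp (\<i> * complex_of_real (pi / R * ((rvec k \<bullet> b) * x)))" for b x
  interpret product_sigma_finite "\<lambda>_::real^3. lborel :: real measure" ..
  have int: "integrable lborel (g b)" for b
    unfolding g_def
    by (intro borel_integrable_compact continuous_intros compact_Icc)
  \<comment> \<open>Expanding the inner product over \<open>Basis\<close> turns the exponential of a
    sum into a product.\<close>
  have fac: "indicator (cube R) v *\<^sub>R exp (phase R k v) = (\<Prod>b\<in>Basis. g b (v \<bullet> b))" for v
    unfolding indicator_cube phase_def g_def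
    by (subst euclidean_inner[of "rvec k"])
       (simp add: scaleR_conv_of_real prod.distrib exp_sum sum_distrib_left)
  have meas: "(\<lambda>v. \<Prod>b\<in>Basis. g b (v \<bullet> b)) \<in> borel_measurable borel"
    using int by (auto intro!: borel_measurable_prod measurable_compose[where g = "g _"]
        dest: borel_measurable_integrable)
  have "(LINT v:cube R|lborel. exp (phase R k v)) = (LINT v|lborel. (\<Prod>b\<in>Basis. g b (v \<bullet> b)))"
    by (simp add: set_lebesgue_integral_def fac)
  \<comment> \<open>Lebesgue measure is the image of the product measure on coordinates;
    \<open>meas\<close> justifies the change of variables.\<close>
  also have "\<dots> = (LINT x|Pi\<^sub>M Basis (\<lambda>_. lborel). (\<Prod>b\<in>Basis. g b (x b)))"
    by (subst lborel_eq, subst integral_distr)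
       (auto intro!: Bochner_Integration.integral_cong prod.cong meas)
  also have "\<dots> = (\<Prod>b\<in>Basis. LINT x|lborel. g b x)"
    by (rule product_integral_prod) (auto intro: int)
  also have "\<dots> = 0"
  proof -
    have "(LINT x|lborel. g (axis i 1) x) = 0"
      using integral_exp_period [OF assms]
      by (simp add: g_def set_lebesgue_integral_def inner_axis rvec_def)
    then show ?thesis
      by (intro prod_zero) (auto intro!: bexI[of _ "axis i 1"])
  qed
  finally show ?thesis .
qed

lemma indicator_divergence_interp_vec:
  "indicator (cube R) v *\<^sub>R divergence (interp_vec R n H) v =
     (\<Sum>i\<in>UNIV. \<Sum>k\<in>grid_index n.
        interp_coeff R n (\<lambda>w. H w $ i) k * phase R k (axis i 1) *
        (indicator (cube R) v *\<^sub>R exp (phase R k v)))"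
  by (simp add: divergence_interp_vec scaleR_sum_right)

text \<open>Since the integral of a non-integrable function is 0 by convention, integrability is
  what gives the vanishing integral its meaning.\<close>

lemma set_integrable_divergence_interp_vec:
  "set_integrable lborel (cube R) (divergence (interp_vec R n H))"
  unfolding set_integrable_def indicator_divergence_interp_vec
  by (intro Bochner_Integration.integrable_sum Bochner_Integration.integrable_mult_right
      set_integrable_exp_phase[unfolded set_integrable_def])

lemma integral_divergence_interp_vec:
  assumes "R > 0"
  shows "(LINT v:cube R|lborel. divergence (interp_vec R n H) v) = 0"
proof -
  let ?e = "\<lambda>k v. indicator (cube R) v *\<^sub>R exp (phase R k v)"
  let ?c = "\<lambda>i k. interp_coeff R n (\<lambda>w. H w $ i) k * phase R k (axis i 1)"
  have int: "integrable lborel (\<lambda>v. ?c i k * ?e k v)" for i k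
    by (intro Bochner_Integration.integrable_mult_right
        set_integrable_exp_phase[unfolded set_integrable_def])
  \<comment> \<open>Either differentiation in direction i kills the mode, or its integral vanishes
    because of that same nonzero component.\<close>
  have zero: "(LINT v|lborel. ?c i k * ?e k v) = 0" for i k
    using integral_exp_phase[OF assms, of k i]
    by (cases "k $ i = 0")
       (simp_all add: phase_axis set_lebesgue_integral_def del: mult_scaleR_right)
  have "(LINT v:cube R|lborel. divergence (interp_vec R n H) v) =
      (\<Sum>i\<in>UNIV. LINT v|lborel. (\<Sum>k\<in>grid_index n. ?c i k * ?e k v))"
    unfolding set_lebesgue_integral_def indicator_divergence_interp_vec
    by (intro Bochner_Integration.integral_sum Bochner_Integration.integrable_sum int)
  also have "\<dots> = (\<Sum>i\<in>UNIV. \<Sum>k\<in>grid_index n. LINT v|lborel. ?c i k * ?e k v)"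
    by (intro sum.cong refl Bochner_Integration.integral_sum int)
  also have "\<dots> = 0"
    by (simp only: zero sum.neutral_const)
  finally show ?thesis .
qed

theorem mainTheorem2:
  fixes R :: real and n :: nat and f :: "real ^ 3 \<Rightarrow> real"
  assumes "R > 0" and "n > 0" and "even n"
  shows "set_integrable lborel (cube R) (collocation_op R n f)
    \<and> (LINT v:cube R|lborel. collocation_op R n f v) =
        (LINT v:cube R|lborel.
           divergence (interp_vec R n (\<lambda>w.
             hessian (conv_potential R n f) w *v grad (interpolant R n f) w
             - interpolant R n f w *s grad (laplacian (conv_potential R n f)) w)) v)
    \<and> (LINT v:cube R|lborel. collocation_op R n f v) = 0"
  using set_integrable_divergence_interp_vec integral_divergence_interp_vec[OF \<open>R > 0\<close>]
  unfolding collocation_op_def by blast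

end
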